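(* Let $Q\geq 1$ be an integer. The $Q$-band-connected RIS is planar-connected if and only if $Q\leq 3$.
   Context: An $N$-element beyond-diagonal reconfigurable intelligent surface (BD-RIS) is represented by a finite simple undirected graph $\mathcal{G}=\mathcal{G}_N=(\mathcal{V},\mathcal{E})$ with vertex set $\mathcal{V}=\{v_1,\ldots,v_N\}$ (one vertex per RIS element), where $v_n$ and $v_m$ ($n\neq m$) are joined by an edge if and only if a tunable admittance component interconnects elements $n$ and $m$. A BD-RIS architecture is a rule assigning such a graph $\mathcal{G}_N$ to each number of elements $N$. A graph is planar if it can be drawn in the plane with no edges crossing. A BD-RIS architecture is planar-connected if its associated graph $\mathcal{G}_N$ is planar for any number of RIS elements $N\geq 1$. The $Q$-band-connected RIS is the architecture in which distinct elements $n$ and $m$ are interconnected if and only if $|n-m|\leq Q$, i.e., $v_n$ and $v_m$ with $n\neq m$ are adjacent in $\mathcal{G}_N$ if and only if $|n-m|\leq Q$, for $n,m=1,\ldots,N$. *)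

theory Defs
  imports "HOL-Analysis.Analysis"
begin

(* An undirected graph is a pair (V, E); edges are unordered pairs of vertices, as sets. *)
type_synonym 'a ugraph = "'a set \<times> 'a set set"

definition simple_graph :: "'a ugraph \<Rightarrow> bool" where
  "simple_graph G \<longleftrightarrow>
     finite (fst G) \<and> (\<forall>e\<in>snd G. e \<subseteq> fst G \<and> card e = 2)"

(* A drawing in the plane, represented by the type complex: distinct vertices go to distinct
   points, an edge e to a simple curve (c e) joining the images of its end vertices and
   passing through no other vertex, and two curves meet only in images of shared end vertices. *)
definition plane_drawing ::
    "'a ugraph \<Rightarrow> ('a \<Rightarrow> complex) \<Rightarrow> ('a set \<Rightarrow> real \<Rightarrow> complex) \<Rightarrow> bool" where
  "plane_drawing G p c \<longleftrightarrow>
     inj_on p (fst G) \<and>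
     (\<forall>e\<in>snd G. arc (c e) \<and>
                {pathstart (c e), pathfinish (c e)} = p ` e \<and>
                path_image (c e) \<inter> p ` fst G = p ` e) \<and>
     (\<forall>e\<in>snd G. \<forall>f\<in>snd G. e \<noteq> f \<longrightarrow>
                path_image (c e) \<inter> path_image (c f) \<subseteq> p ` (e \<inter> f))"

definition planar :: "'a ugraph \<Rightarrow> bool" where
  "planar G \<longleftrightarrow> (\<exists>p c. plane_drawing G p c)"

(* An architecture assigns to each number N of elements a graph; element n is the vertex n,
   for n = 1, ..., N. *)
type_synonym architecture = "nat \<Rightarrow> nat ugraph"

definition bd_ris_architecture :: "architecture \<Rightarrow> bool" where
  "bd_ris_architecture A \<longleftrightarrow> (\<forall>N\<ge>1. simple_graph (A N) \<and> fst (A N) = {1..N})"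

definition planar_connected :: "architecture \<Rightarrow> bool" where
  "planar_connected A \<longleftrightarrow> (\<forall>N\<ge>1. planar (A N))"

definition band_connected_ris :: "nat \<Rightarrow> architecture" where
  "band_connected_ris Q N =
     ({1..N},
      {{n, m} | n m. n \<in> {1..N} \<and> m \<in> {1..N} \<and> n \<noteq> m \<and> \<bar>int n - int m\<bar> \<le> int Q})"

lemma bd_ris_architecture_band_connected_ris: "bd_ris_architecture (band_connected_ris Q)"
  by (auto simp: bd_ris_architecture_def simple_graph_def band_connected_ris_def)

lemma band_connected_ris_edge_iff:
  assumes "n \<in> {1..N}" and "m \<in> {1..N}" and "n \<noteq> m"
  shows "{n, m} \<in> snd (band_connected_ris Q N) \<longleftrightarrow> \<bar>int n - int m\<bar> \<le> int Q"
  using assms by (auto simp: band_connected_ris_def doubleton_eq_iff)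

end

theory Submission
  imports Defs
begin

text \<open>
  For \<open>Q \<le> 3\<close>, place element \<open>n\<close> at distance proportional to \<open>n\<close> on the ray number \<open>n mod 3\<close> out of
  three rays whose directions sum to zero, and draw edges as straight segments. Edges \<open>{n, n + 3}\<close>
  are consecutive pieces of a ray, and the edges between two rays form a zigzag that moves
  monotonically outwards, so nothing crosses.

  For \<open>Q \<ge> 4\<close>, the first five elements form a \<open>K\<^sub>5\<close>. Suppose it is drawn, and consider a triangle
  \<open>abc\<close> with \<open>d\<close> in its inside; then \<open>e\<close> is inside too, because the arc \<open>de\<close> does not meet the triangle.
  By the theta-curve theorem the arcs \<open>ad\<close>, \<open>bd\<close>, \<open>cd\<close> split the inside of \<open>abc\<close> into the insides of \<open>abd\<close>, \<open>acd\<close>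
  and \<open>bcd\<close>, and if \<open>e\<close> is in the first, say, then the arc \<open>ec\<close> has to cross \<open>abd\<close>. If instead \<open>d\<close>
  and \<open>e\<close> are outside \<open>abc\<close>, then so are all the other arcs, and the inversion in a point inside
  \<open>abc\<close> leads back to the first case.
\<close>

subsection \<open>Arcs and the insides of closed curves\<close>

definition arc_between :: "complex set \<Rightarrow> complex \<Rightarrow> complex \<Rightarrow> bool" where
  "arc_between A x y \<longleftrightarrow> (\<exists>g. arc g \<and> path_image g = A \<and> pathstart g = x \<and> pathfinish g = y)"

lemma arc_between_commute: "arc_between A x y \<longleftrightarrow> arc_between A y x"
  unfolding arc_between_def
  by (metis arc_reversepath path_image_reversepath pathfinish_reversepath pathstart_reversepath)

lemma arc_between_ends:
  assumes "arc_between A x y"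
  shows "x \<in> A" "y \<in> A" "x \<noteq> y"
  using assms unfolding arc_between_def by (auto dest: arc_distinct_ends)

lemma arc_between_join:
  assumes "arc_between A x y" "arc_between B y z" "A \<inter> B \<subseteq> {y}"
  shows "arc_between (A \<union> B) x z"
proof -
  obtain g h where "arc g" "path_image g = A" "pathstart g = x" "pathfinish g = y"
      "arc h" "path_image h = B" "pathstart h = y" "pathfinish h = z"
    using assms unfolding arc_between_def by blast
  then show ?thesis
    using assms(3) unfolding arc_between_def
    by (intro exI[of _ "g +++ h"]) (simp add: arc_join path_image_join)
qed

lemma compact_arc_between: "arc_between A x y \<Longrightarrow> compact A"
  unfolding arc_between_def using compact_arc_image by blast

lemma connected_arc_between: "arc_between A x y \<Longrightarrow> connected A"
  unfolding arc_between_def using connected_arc_image by blast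

text \<open>For an arc that touches a closed curve only at its first end: the rest of the arc is
  connected and misses the curve, so it lies on a single side.\<close>

lemma connected_arc_between_Diff:
  assumes "arc_between A x y"
  shows "connected (A - {x})"
proof -
  obtain g where g: "arc g" "path_image g = A" "pathstart g = x"
    using assms unfolding arc_between_def by blast
  have inj: "inj_on g {0..1}" and con: "continuous_on {0..1} g"
    using g(1) by (auto simp: arc_def path_def)
  have *: "({0..1} :: real set) - {0} = {0<..1}"
    by auto
  have "A - {x} = g ` {0..1} - g ` {0}"
    using g by (simp add: path_image_def pathstart_def)
  also have "\<dots> = g ` {0<..1}"
    using inj_on_image_set_diff[OF inj, of "{0..1}" "{0}"] * by (simp add: subset_iff)
  finally show ?thesis
    by (auto intro!: connected_continuous_image continuous_on_subset[OF con])
qed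

lemma arc_between_third_point:
  assumes "arc_between A x y"
  obtains q where "q \<in> A" "q \<noteq> x" "q \<noteq> y"
proof -
  obtain g where "arc g" "path_image g = A" "pathstart g = x" "pathfinish g = y"
    using assms unfolding arc_between_def by blast
  then show ?thesis
    using nonempty_simple_path_endless[of g] arc_imp_simple_path that by fastforce
qed

lemma connected_subset_inside:
  assumes "connected T" "T \<inter> S = {}" "x \<in> T" "x \<in> inside S"
  shows "T \<subseteq> inside S"
proof
  fix y assume "y \<in> T"
  then have "connected_component (- S) x y"
    using assms unfolding connected_component_def by blast
  then show "y \<in> inside S"
    using assms(4) inside_same_component by blast
qed

text \<open>This is \<open>split_inside_simple_closed_curve\<close> in terms of point sets, so that
  paths glued from several edges can be used without tracking their parametrisations.\<close>

lemma theta_inside: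
  assumes "arc_between A x y" "arc_between B x y" "arc_between C x y"
    and "A \<inter> B = {x, y}" "A \<inter> C = {x, y}" "B \<inter> C = {x, y}"
    and "C \<inter> inside (A \<union> B) \<noteq> {}"
  shows "inside (A \<union> C) \<union> inside (B \<union> C) \<union> (C - {x, y}) = inside (A \<union> B)"
proof -
  obtain g h k where "arc g" "path_image g = A" "pathstart g = x" "pathfinish g = y"
      "arc h" "path_image h = B" "pathstart h = x" "pathfinish h = y"
      "arc k" "path_image k = C" "pathstart k = x" "pathfinish k = y"
    using assms(1-3) unfolding arc_between_def by blast
  then show ?thesis
    using split_inside_simple_closed_curve[of g x y h k] assms(4-7) arc_imp_simple_path
      arc_between_ends(3)[OF assms(1)] by metis
qed

text \<open>By the Jordan curve theorem; it later supplies the centre of the inversion.\<close>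

lemma inside_arc_loop_nonempty:
  assumes "arc_between A x y" "arc_between B y x" "A \<inter> B \<subseteq> {x, y}"
  shows "inside (A \<union> B) \<noteq> {}"
proof -
  obtain g h where gh: "arc g" "path_image g = A" "pathstart g = x" "pathfinish g = y"
      "arc h" "path_image h = B" "pathstart h = y" "pathfinish h = x"
    using assms(1,2) unfolding arc_between_def by blast
  then have "simple_path (g +++ h)"
    using assms(3) by (intro simple_path_join_loop) auto
  then show ?thesis
    using Jordan_inside_outside[of "g +++ h"] gh by (simp add: path_image_join)
qed

text \<open>A component of the complement of the image, minus the origin, is pulled back to a connected
  set outside \<open>S\<close>, which avoids a ball around \<open>z0\<close>; so the component is bounded.\<close>

lemma inversion_outside_to_inside:
  fixes S :: "complex set"
  assumes "compact S" "z0 \<in> inside S" "x \<in> outside S"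
  shows "inverse (x - z0) \<in> inside ((\<lambda>z. inverse (z - z0)) ` S)"
proof -
  define f where "f = (\<lambda>z. inverse (z - z0))"
  define g where "g = (\<lambda>w. z0 + inverse w)"
  have gf: "g (f z) = z" and fg: "f (g z) = z" for z
    by (auto simp: f_def g_def)
  have z0S: "z0 \<notin> S" and xS: "x \<notin> S" and xz0: "x \<noteq> z0"
    using assms by (auto simp: inside_def outside_def)
  obtain r where r: "r > 0" "ball z0 r \<subseteq> inside S"
    using open_inside[OF compact_imp_closed[OF assms(1)]] assms(2) openE by blast
  have "0 \<notin> f ` S"
    using z0S by (auto simp: f_def)
  have notin: "f x \<notin> f ` S"
    using xS gf by (metis imageE)
  define K where "K = connected_component_set (- (f ` S)) (f x)"
  have "compact (f ` S)"
    unfolding f_def using assms(1) z0S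
    by (intro compact_continuous_image continuous_intros) auto
  then have "open K"
    unfolding K_def by (intro open_connected_component) (auto dest: compact_imp_closed)
  \<comment> \<open>Since \<open>inverse 0 = 0\<close>, \<open>g\<close> sends the origin to
    \<open>z0\<close> instead of infinity and is discontinuous there. Deleting one point keeps an
    open connected set in the plane connected.\<close>
  then have "connected (K - {0})"
    unfolding K_def by (intro connected_open_delete) auto
  moreover have "continuous_on (K - {0}) g"
    unfolding g_def by (intro continuous_intros) auto
  ultimately have con: "connected (g ` (K - {0}))"
    by (rule connected_continuous_image[rotated])
  have "x \<in> g ` (K - {0})"
  proof
    show "x = g (f x)" by (simp add: gf)
    show "f x \<in> K - {0}"
      using notin xz0 by (simp add: K_def f_def)
  qed
  moreover have "g ` (K - {0}) \<inter> S = {}"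
  proof -
    have "K \<subseteq> - (f ` S)"
      unfolding K_def by (rule connected_component_subset)
    moreover have "w \<in> f ` S" if "g w \<in> S" for w
      using that fg[of w] by (metis imageI)
    ultimately show ?thesis
      by blast
  qed
  ultimately have "g ` (K - {0}) \<inter> inside S = {}"
    using connected_subset_inside[OF con] assms(3) inside_Int_outside by blast
  then have *: "g w \<notin> ball z0 r" if "w \<in> K" "w \<noteq> 0" for w
    using r that by blast
  have "norm w \<le> inverse r" if "w \<in> K" for w
  proof (cases "w = 0")
    case False
    then have "r \<le> inverse (norm w)"
      using *[OF that] by (simp add: g_def dist_norm norm_inverse)
    then show ?thesis
      using r(1) False by (simp add: field_simps)
  qed (use r in simp)
  then have "bounded K"
    unfolding bounded_iff by blast
  then show ?thesis
    using notin unfolding inside_def K_def f_def by simp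
qed

subsection \<open>The complete graph on five vertices\<close>

text \<open>The map is controlled only on a set \<open>S\<close> carrying the drawing, because the
  inversion is discontinuous at its centre.\<close>

lemma plane_drawing_image:
  assumes "plane_drawing G p c" "inj_on f S" "continuous_on S f"
    and pS: "p ` fst G \<subseteq> S" and cS: "\<And>e. e \<in> snd G \<Longrightarrow> path_image (c e) \<subseteq> S"
    and sub: "\<And>e. e \<in> snd G \<Longrightarrow> e \<subseteq> fst G"
  shows "plane_drawing G (f \<circ> p) (\<lambda>e. f \<circ> c e)"
  unfolding plane_drawing_def
proof (intro conjI ballI impI)
  note d = assms(1)[unfolded plane_drawing_def]
  show "inj_on (f \<circ> p) (fst G)"
    using d pS by (auto intro!: comp_inj_on inj_on_subset[OF assms(2)])
  fix e assume e: "e \<in> snd G"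
  show "arc (f \<circ> c e)"
  proof -
    have "arc (c e)" using d e by blast
    moreover have "c e ` {0..1} \<subseteq> S"
      using cS[OF e] by (simp add: path_image_def)
    ultimately show ?thesis
      unfolding arc_def
      by (auto intro!: comp_inj_on inj_on_subset[OF assms(2)] path_continuous_image
          continuous_on_subset[OF assms(3)] simp: path_image_def)
  qed
  show "{pathstart (f \<circ> c e), pathfinish (f \<circ> c e)} = (f \<circ> p) ` e"
  proof -
    have "{pathstart (c e), pathfinish (c e)} = p ` e" using d e by blast
    then have "f ` {pathstart (c e), pathfinish (c e)} = f ` p ` e" by (rule arg_cong)
    then show ?thesis
      by (simp add: pathstart_compose pathfinish_compose image_comp)
  qed
  show "path_image (f \<circ> c e) \<inter> (f \<circ> p) ` fst G = (f \<circ> p) ` e"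
    using d e inj_on_image_Int[OF assms(2) cS[OF e] pS]
    by (simp add: path_image_compose image_comp)
  fix e' assume e': "e' \<in> snd G" "e \<noteq> e'"
  then have "path_image (c e) \<inter> path_image (c e') \<subseteq> p ` (e \<inter> e')"
    using d e by blast
  then have "f ` (path_image (c e) \<inter> path_image (c e')) \<subseteq> f ` p ` (e \<inter> e')"
    by (rule image_mono)
  then show "path_image (f \<circ> c e) \<inter> path_image (f \<circ> c e') \<subseteq> (f \<circ> p) ` (e \<inter> e')"
    using inj_on_image_Int[OF assms(2) cS[OF e] cS[OF e'(1)]]
    by (simp add: path_image_compose image_comp)
qed

section \<open>Edges and triangles of a drawn complete graph\<close>

definition complete_graph :: "'a set \<Rightarrow> 'a ugraph" where
  "complete_graph V = (V, {e. e \<subseteq> V \<and> card e = 2})"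

text \<open>A locale, because its results are applied to two drawings of the same graph: the given
  one and its image under the inversion.\<close>

locale complete_drawing =
  fixes V :: "'a set" and p :: "'a \<Rightarrow> complex" and g :: "'a set \<Rightarrow> real \<Rightarrow> complex"
  assumes drawing: "plane_drawing (complete_graph V) p g"
begin

definition E :: "'a \<Rightarrow> 'a \<Rightarrow> complex set" where
  "E i j = path_image (g {i, j})"

definition tri :: "'a \<Rightarrow> 'a \<Rightarrow> 'a \<Rightarrow> complex set" where
  "tri i j k = E i j \<union> E i k \<union> E j k"

lemma E_commute: "E i j = E j i"
  by (simp add: E_def insert_commute)

lemma tri_commute: "tri i j k = tri i k j" "tri i j k = tri j i k"
  by (auto simp: tri_def E_commute)

lemma inj_on_p: "inj_on p V"
  using drawing by (simp add: plane_drawing_def complete_graph_def)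

lemma edge:
  assumes "i \<in> V" "j \<in> V" "i \<noteq> j"
  shows "arc (g {i, j})" "{pathstart (g {i, j}), pathfinish (g {i, j})} = {p i, p j}"
    "E i j \<inter> p ` V = {p i, p j}"
  using drawing assms by (auto simp: plane_drawing_def complete_graph_def E_def)

lemma arc_E:
  assumes "i \<in> V" "j \<in> V" "i \<noteq> j"
  shows "arc_between (E i j) (p i) (p j)"
proof -
  have "arc_between (E i j) (pathstart (g {i, j})) (pathfinish (g {i, j}))"
    using edge[OF assms] unfolding arc_between_def E_def by blast
  then show ?thesis
    using edge(2)[OF assms] by (metis arc_between_commute doubleton_eq_iff)
qed

lemma p_mem_E:
  assumes "i \<in> V" "j \<in> V" "i \<noteq> j" "k \<in> V"
  shows "p k \<in> E i j \<longleftrightarrow> k = i \<or> k = j"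
proof -
  have "p k \<in> E i j \<longleftrightarrow> p k \<in> {p i, p j}"
    using edge(3)[OF assms(1-3)] assms(4) by blast
  then show ?thesis
    using inj_on_p assms by (auto dest: inj_onD)
qed

lemma E_Int:
  assumes "i \<in> V" "j \<in> V" "i \<noteq> j" "k \<in> V" "l \<in> V" "k \<noteq> l" "{i, j} \<noteq> {k, l}"
  shows "E i j \<inter> E k l = p ` ({i, j} \<inter> {k, l})"
proof
  show "E i j \<inter> E k l \<subseteq> p ` ({i, j} \<inter> {k, l})"
    using drawing assms by (simp add: plane_drawing_def complete_graph_def E_def)
  show "p ` ({i, j} \<inter> {k, l}) \<subseteq> E i j \<inter> E k l"
    using assms by (auto simp: p_mem_E)
qed

lemma E_Int_adjacent:
  assumes "i \<in> V" "j \<in> V" "k \<in> V" "i \<noteq> j" "i \<noteq> k" "j \<noteq> k"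
  shows "E i j \<inter> E i k = {p i}" "E i j \<inter> E k i = {p i}"
    "E j i \<inter> E i k = {p i}" "E j i \<inter> E k i = {p i}"
proof -
  show "E i j \<inter> E i k = {p i}"
    using assms by (subst E_Int) (auto simp: doubleton_eq_iff)
  then show "E i j \<inter> E k i = {p i}" "E j i \<inter> E i k = {p i}" "E j i \<inter> E k i = {p i}"
    by (simp_all add: E_commute)
qed

lemma E_Int_disjoint:
  assumes "i \<in> V" "j \<in> V" "k \<in> V" "l \<in> V" "distinct [i, j, k, l]"
  shows "E i j \<inter> E k l = {}"
  using assms by (subst E_Int) (auto simp: doubleton_eq_iff)

lemma p_mem_tri:
  assumes "i \<in> V" "j \<in> V" "k \<in> V" "l \<in> V" "distinct [i, j, k]"
  shows "p l \<in> tri i j k \<longleftrightarrow> l \<in> {i, j, k}"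
  using assms by (auto simp: tri_def p_mem_E)

lemma p_mem_inside_tri:
  assumes "p l \<in> inside (tri i j k)" "i \<in> V" "j \<in> V" "k \<in> V" "l \<in> V" "distinct [i, j, k]"
  shows "l \<notin> {i, j, k}"
  using p_mem_tri[OF assms(2-6)] assms(1) inside_no_overlap by blast

section \<open>Two-edge paths and theta curves\<close>

lemma arc_E2:
  assumes "i \<in> V" "j \<in> V" "k \<in> V" "distinct [i, j, k]"
  shows "arc_between (E i k \<union> E k j) (p i) (p j)"
  using assms E_Int_adjacent(3)[of k i j] by (intro arc_between_join[of _ _ "p k"] arc_E) auto

lemma E2_Int_E2:
  assumes "i \<in> V" "j \<in> V" "k \<in> V" "l \<in> V" "distinct [i, j, k, l]"
  shows "(E i k \<union> E k j) \<inter> (E i l \<union> E l j) = {p i, p j}"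
proof -
  have "distinct [l, k, j, i]"
    using assms by auto
  then have "E i k \<inter> E i l = {p i}" "E k j \<inter> E l j = {p j}" "E i k \<inter> E l j = {}" "E k j \<inter> E i l = {}"
    using assms by (simp_all add: E_Int_adjacent E_Int_disjoint)
  then show ?thesis by blast
qed

lemma E_Int_E2:
  assumes "i \<in> V" "j \<in> V" "k \<in> V" "distinct [i, j, k]"
  shows "E i j \<inter> (E i k \<union> E k j) = {p i, p j}"
proof -
  have "distinct [k, j, i]"
    using assms by auto
  then have "E i j \<inter> E i k = {p i}" "E i j \<inter> E k j = {p j}"
    using assms by (simp_all add: E_Int_adjacent)
  then show ?thesis by blast
qed

text \<open>The theta curve has ends \<open>a\<close> and \<open>b\<close> and consists of the edge
  \<open>ab\<close> and the paths through \<open>c\<close> and through \<open>d\<close>; the last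
  one meets the inside because \<open>d\<close> is there. What remains beside \<open>abd\<close> is
  the quadrilateral \<open>acbd\<close>.\<close>

lemma tri_split:
  assumes "a \<in> V" "b \<in> V" "c \<in> V" "d \<in> V" "distinct [a, b, c, d]"
    and "p d \<in> inside (tri a b c)"
  shows "inside (tri a b d) \<union> inside ((E a c \<union> E c b) \<union> (E a d \<union> E d b)) \<union>
           ((E a d \<union> E d b) - {p a, p b}) = inside (tri a b c)"
proof -
  have "tri a b c = E a b \<union> (E a c \<union> E c b)" "tri a b d = E a b \<union> (E a d \<union> E d b)"
    by (auto simp: tri_def E_commute)
  moreover have "p d \<in> E a d"
    using assms by (simp add: p_mem_E)
  ultimately show ?thesis
    using assms theta_inside[of "E a b" "p a" "p b" "E a c \<union> E c b" "E a d \<union> E d b"]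
    by (auto simp: E_Int_E2 E2_Int_E2 arc_E arc_E2)
qed

text \<open>The arc \<open>ec\<close> is disjoint from \<open>abd\<close>, so it would carry
  \<open>c\<close> into the inside of \<open>abd\<close>, hence of \<open>abc\<close>, although
  \<open>c\<close> lies on \<open>abc\<close>.\<close>

lemma not_inside_subtri:
  assumes V: "a \<in> V" "b \<in> V" "c \<in> V" "d \<in> V" "e \<in> V" and dist: "distinct [a, b, c, d, e]"
    and d: "p d \<in> inside (tri a b c)"
  shows "p e \<notin> inside (tri a b d)"
proof
  assume e: "p e \<in> inside (tri a b d)"
  have "distinct [e, d, c, b, a]"
    using dist by auto
  then have "E e c \<inter> tri a b d = {}"
    using V dist unfolding tri_def by (simp add: Int_Un_distrib E_Int_disjoint)
  moreover have "connected (E e c)" "p e \<in> E e c" "p c \<in> E e c"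
    using arc_E[of e c] V dist by (auto simp: connected_arc_between arc_between_ends)
  ultimately have "p c \<in> inside (tri a b d)"
    using connected_subset_inside e by blast
  then have "p c \<in> inside (tri a b c)"
    using tri_split[of a b c d] V dist d by auto
  then show False
    using p_mem_inside_tri[of c a b c] V dist by simp
qed

text \<open>Two theta curves in succession: the path \<open>adb\<close> separates \<open>abd\<close>
  from the quadrilateral \<open>acbd\<close>, and the arc \<open>cd\<close> then cuts the
  quadrilateral into \<open>acd\<close> and \<open>bcd\<close>. None of the pieces can contain
  \<open>e\<close>.\<close>

lemma not_both_inside:
  assumes V: "a \<in> V" "b \<in> V" "c \<in> V" "d \<in> V" "e \<in> V" and dist: "distinct [a, b, c, d, e]"
    and d: "p d \<in> inside (tri a b c)"
  shows "p e \<notin> inside (tri a b c)"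
proof
  assume e: "p e \<in> inside (tri a b c)"
  have dist': "distinct [e, d, c, b, a]"
    using dist by auto
  let ?Q = "inside ((E a c \<union> E c b) \<union> (E a d \<union> E d b))"
  have split: "inside (tri a b d) \<union> ?Q \<union> ((E a d \<union> E d b) - {p a, p b}) = inside (tri a b c)"
    using tri_split[of a b c d] V dist dist' d by auto
  have "p e \<notin> inside (tri a b d)"
    using not_inside_subtri[of a b c d e] V dist dist' d by auto
  moreover have "p e \<notin> E a d \<union> E d b"
    using V dist dist' by (simp add: p_mem_E)
  ultimately have eQ: "p e \<in> ?Q"
    using split e by blast

  \<comment> \<open>For the second cut, \<open>theta_inside\<close> needs a point of
    \<open>cd\<close> inside the quadrilateral. An inner point \<open>q\<close> of the arc is shown
    to be one by excluding the other pieces of the first split.\<close>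
  obtain q where q: "q \<in> E c d" "q \<noteq> p c" "q \<noteq> p d"
    using arc_between_third_point[OF arc_E[of c d]] V dist dist' by auto
  have arcs: "arc_between (E c d) (p c) (p d)" "arc_between (E c d) (p d) (p c)"
    using V dist dist' by (auto intro: arc_E simp: arc_between_commute[of _ "p d"])
  have Int_tri: "E c d \<inter> tri a b c = {p c}" "E c d \<inter> tri a b d = {p d}"
  proof -
    have "E c d \<inter> E a b = {}" "E c d \<inter> E a c = {p c}" "E c d \<inter> E b c = {p c}"
      "E c d \<inter> E a d = {p d}" "E c d \<inter> E b d = {p d}"
      using V dist dist' by (simp_all add: E_Int_adjacent E_Int_disjoint)
    then show "E c d \<inter> tri a b c = {p c}" "E c d \<inter> tri a b d = {p d}"
      unfolding tri_def by blast+
  qed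
  have "E c d - {p c} \<subseteq> inside (tri a b c)"
    using Int_tri(1) arc_between_ends[OF arcs(1)] d
    by (intro connected_subset_inside[OF connected_arc_between_Diff[OF arcs(1)]]) auto
  then have "q \<in> inside (tri a b c)"
    using q by blast
  \<comment> \<open>As \<open>cd\<close> meets \<open>abd\<close> only in \<open>d\<close>, an inner
    point inside \<open>abd\<close> would pull \<open>c\<close> in as well.\<close>
  moreover have "q \<notin> inside (tri a b d)"
  proof
    assume "q \<in> inside (tri a b d)"
    then have "E c d - {p d} \<subseteq> inside (tri a b d)"
      using Int_tri(2) q
      by (intro connected_subset_inside[OF connected_arc_between_Diff[OF arcs(2)]]) auto
    then have "p c \<in> inside (tri a b c)"
      using split arc_between_ends[OF arcs(1)] by blast
    then show False
      using p_mem_inside_tri[of c a b c] V dist dist' by simp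
  qed
  moreover have "q \<notin> E a d \<union> E d b"
    using q Int_tri(2) by (auto simp: tri_def E_commute)
  ultimately have qQ: "q \<in> ?Q"
    using split by blast

  \<comment> \<open>The boundary of the quadrilateral is regrouped from two paths between
    \<open>a\<close> and \<open>b\<close> into two paths between \<open>c\<close> and
    \<open>d\<close>.\<close>
  have Q: "(E c a \<union> E a d) \<union> (E c b \<union> E b d) = (E a c \<union> E c b) \<union> (E a d \<union> E d b)"
    by (auto simp: E_commute)
  have tris: "(E c a \<union> E a d) \<union> E c d = tri a c d" "(E c b \<union> E b d) \<union> E c d = tri b c d"
    by (auto simp: tri_def E_commute)
  have "inside (tri a c d) \<union> inside (tri b c d) \<union> (E c d - {p c, p d}) = ?Q"
    using theta_inside[of "E c a \<union> E a d" "p c" "p d" "E c b \<union> E b d" "E c d"] V dist dist' q qQ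
    unfolding Q tris
    by (auto simp: E_Int_E2 E2_Int_E2 arc_E arc_E2 Int_commute[of _ "E c d"])
  moreover have "p e \<notin> inside (tri a c d)"
    using not_inside_subtri[of a c b d e] V dist dist' d by (auto simp: tri_commute)
  moreover have "p e \<notin> inside (tri b c d)"
    using not_inside_subtri[of b c a d e] V dist dist' d by (auto simp: tri_commute)
  moreover have "p e \<notin> E c d"
    using V dist dist' by (simp add: p_mem_E)
  ultimately show False
    using eQ by blast
qed

lemma inside_tri_other:
  assumes V: "a \<in> V" "b \<in> V" "c \<in> V" "d \<in> V" "e \<in> V" and dist: "distinct [a, b, c, d, e]"
    and d: "p d \<in> inside (tri a b c)"
  shows "p e \<in> inside (tri a b c)"
proof -
  have "distinct [e, d, c, b, a]"
    using dist by auto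
  then have "E d e \<inter> tri a b c = {}"
    using V dist unfolding tri_def by (simp add: Int_Un_distrib E_Int_disjoint)
  moreover have "connected (E d e)" "p d \<in> E d e" "p e \<in> E d e"
    using arc_E[of d e] V dist by (auto simp: connected_arc_between arc_between_ends)
  ultimately show ?thesis
    using connected_subset_inside d by blast
qed

text \<open>This makes any point inside \<open>abc\<close> a legitimate centre of inversion: the
  whole drawing avoids it.\<close>

lemma E_Int_inside_tri:
  assumes V: "a \<in> V" "b \<in> V" "c \<in> V" "i \<in> V" "j \<in> V" and dist: "distinct [a, b, c]" "i \<noteq> j"
    and out: "\<And>v. v \<in> V \<Longrightarrow> p v \<notin> inside (tri a b c)"
  shows "E i j \<inter> inside (tri a b c) = {}"
proof -
  \<comment> \<open>With \<open>i\<close> not a corner, the edge meets the triangle at most in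
    \<open>p j\<close>. Once inside it could not get out before reaching \<open>p i\<close>, which
    is not inside.\<close>
  have *: "E i j \<inter> inside (tri a b c) = {}"
    if V': "i \<in> V" "j \<in> V" "i \<noteq> j" and i: "i \<notin> {a, b, c}" for i j
  proof (rule ccontr)
    assume "E i j \<inter> inside (tri a b c) \<noteq> {}"
    then obtain q where q: "q \<in> E i j" "q \<in> inside (tri a b c)" by blast
    have E: "E i j \<inter> E k l \<subseteq> {p j}" if "k \<in> {a, b, c}" "l \<in> {a, b, c}" "k \<noteq> l" for k l
    proof -
      have "E i j \<inter> E k l = p ` ({i, j} \<inter> {k, l})"
        using that V V' i by (intro E_Int) (auto simp: doubleton_eq_iff)
      then show ?thesis using that i by auto
    qed
    have "E i j \<inter> tri a b c \<subseteq> {p j}"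
      using E[of a b] E[of a c] E[of b c] dist by (auto simp: tri_def)
    moreover have arc: "arc_between (E i j) (p j) (p i)"
      using arc_E V' arc_between_commute by blast
    moreover have "q \<noteq> p j"
      using q out V' by blast
    ultimately have "E i j - {p j} \<subseteq> inside (tri a b c)"
      using q
      by (intro connected_subset_inside[OF connected_arc_between_Diff[OF arc]]) auto
    moreover have "p i \<in> E i j - {p j}"
      using arc_between_ends[OF arc] by simp
    ultimately show False
      using out[OF V'(1)] by blast
  qed
  show ?thesis
  proof (cases "i \<in> {a, b, c} \<and> j \<in> {a, b, c}")
    case True
    then have "E i j \<subseteq> tri a b c"
      using dist(2) E_commute[of b a] E_commute[of c a] E_commute[of c b]
      unfolding tri_def by auto
    then show ?thesis
      using inside_no_overlap[of "tri a b c"] by blast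
  next
    case False
    then show ?thesis
      using *[OF V(4,5) dist(2)] *[OF V(5,4) dist(2)[symmetric]] E_commute[of i j] by argo
  qed
qed

lemma compact_tri:
  assumes "a \<in> V" "b \<in> V" "c \<in> V" "distinct [a, b, c]"
  shows "compact (tri a b c)"
  unfolding tri_def using assms
  by (auto intro!: compact_Un compact_arc_between[OF arc_E])

lemma inside_tri_nonempty:
  assumes "a \<in> V" "b \<in> V" "c \<in> V" "distinct [a, b, c]"
  shows "inside (tri a b c) \<noteq> {}"
proof -
  have "tri a b c = E a b \<union> (E a c \<union> E c b)"
    by (auto simp: tri_def E_commute)
  then show ?thesis
    using inside_arc_loop_nonempty[of "E a b" "p a" "p b" "E a c \<union> E c b"] assms
    by (simp add: arc_E arc_E2 E_Int_E2 arc_between_commute[of _ "p b"])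
qed

lemma no_vertex_inside_tri:
  assumes "a \<in> V" "b \<in> V" "c \<in> V" "d \<in> V" "e \<in> V" "distinct [a, b, c, d, e]"
    and "p d \<in> inside (tri a b c)"
  shows False
  using not_both_inside[OF assms] inside_tri_other[OF assms] by blast

end

theorem complete_graph_5_not_planar:
  assumes "card V = 5"
  shows "\<not> planar (complete_graph V)"
proof
  assume "planar (complete_graph V)"
  then obtain p k where drawing: "plane_drawing (complete_graph V) p k"
    unfolding planar_def by blast
  interpret D: complete_drawing V p k
    by standard (fact drawing)
  obtain xs where xs: "set xs = V" "distinct xs" "length xs = 5"
    using assms finite_distinct_list[of V] distinct_card by (metis card.infinite zero_neq_numeral)
  then obtain a b c d e where "xs = [a, b, c, d, e]"
    by (auto simp: length_Suc_conv eval_nat_numeral)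
  with xs have V: "V = {a, b, c, d, e}" and dist: "distinct [a, b, c, d, e]"
    by auto
  have out: "p v \<notin> inside (D.tri a b c)" if "v \<in> V" for v
  proof
    assume v: "p v \<in> inside (D.tri a b c)"
    then have "v \<notin> {a, b, c}"
      using D.p_mem_inside_tri[of v a b c] that V dist by auto
    then show False
      using D.no_vertex_inside_tri[of a b c d e] D.no_vertex_inside_tri[of a b c e d] that V dist v by auto
  qed
  obtain z0 where z0: "z0 \<in> inside (D.tri a b c)"
    using D.inside_tri_nonempty[of a b c] V dist by auto
  define f where "f = (\<lambda>z. inverse (z - z0))"
  have "plane_drawing (complete_graph V) (f \<circ> p) (\<lambda>e. f \<circ> k e)"
  proof (rule plane_drawing_image[OF drawing])
    show "inj_on f (- {z0})"
      by (auto simp: inj_on_def f_def)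
    show "continuous_on (- {z0}) f"
      unfolding f_def by (intro continuous_intros) auto
    show "p ` fst (complete_graph V) \<subseteq> - {z0}"
      using out z0 by (auto simp: complete_graph_def)
    fix e assume e: "e \<in> snd (complete_graph V)"
    then show "e \<subseteq> fst (complete_graph V)"
      by (simp add: complete_graph_def)
    obtain i j where "e = {i, j}" "i \<in> V" "j \<in> V" "i \<noteq> j"
      using e by (auto simp: complete_graph_def card_2_iff)
    then have "path_image (k e) \<inter> inside (D.tri a b c) = {}"
      using D.E_Int_inside_tri[of a b c i j] out V dist by (auto simp: D.E_def)
    then show "path_image (k e) \<subseteq> - {z0}"
      using z0 by blast
  qed
  then interpret D': complete_drawing V "f \<circ> p" "\<lambda>e. f \<circ> k e"
    by unfold_locales
  have tri: "D'.tri a b c = f ` D.tri a b c"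
    by (simp add: D.tri_def D'.tri_def D.E_def D'.E_def path_image_compose image_Un)
  \<comment> \<open>The inversion swaps the roles: \<open>d\<close>, outside the original triangle,
    is inside its image, which the second interpretation forbids.\<close>
  have "p d \<in> outside (D.tri a b c)"
    using out[of d] D.p_mem_tri[of a b c d] V dist by (auto simp: outside_inside)
  moreover have "compact (D.tri a b c)"
    using D.compact_tri[of a b c] V dist by auto
  ultimately have "f (p d) \<in> inside (f ` D.tri a b c)"
    unfolding f_def by (intro inversion_outside_to_inside z0)
  then have "(f \<circ> p) d \<in> inside (D'.tri a b c)"
    unfolding tri by simp
  then show False
    using D'.no_vertex_inside_tri[of a b c d e] V dist by auto
qed

subsection \<open>The straight-line drawing on three rays\<close>

text \<open>Compared with cube roots of unity, these directions keep the coordinates below simple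
  expressions in \<open>Re\<close> and \<open>Im\<close>.\<close>

definition direction :: "nat \<Rightarrow> complex" where
  "direction r = (if r = 0 then 1 else if r = 1 then \<i> else - 1 - \<i>)"

definition point :: "nat \<Rightarrow> complex" where
  "point n = of_nat n * direction (n mod 3)"

text \<open>Since the three directions sum to zero, each point is a nonnegative combination of
  them in which the smallest coefficient is zero; these are its coefficients.\<close>

definition sector_coord :: "nat \<Rightarrow> complex \<Rightarrow> real" where
  "sector_coord j z =
     (let m = Max {0, - Re z, - Im z} in if j = 0 then Re z + m else if j = 1 then Im z + m else m)"

text \<open>The convex combination involves at most two of the three directions, with nonnegative
  coefficients. So its smallest coefficient is already zero and no normalisation takes
  place.\<close>

lemma sector_coord_segment:
  assumes "z = (1 - of_real u) * point n + of_real u * point m" "0 \<le> u" "u \<le> 1" "j < 3"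
  shows "sector_coord j z =
    (if n mod 3 = j then (1 - u) * real n else 0) + (if m mod 3 = j then u * real m else 0)"
proof -
  have "j = 0 \<or> j = 1 \<or> j = 2"
    using assms(4) by auto
  moreover have "n mod 3 = 0 \<or> n mod 3 = 1 \<or> n mod 3 = 2" "m mod 3 = 0 \<or> m mod 3 = 1 \<or> m mod 3 = 2"
    by auto
  moreover have "0 \<le> (1 - u) * real n" "0 \<le> u * real m"
    using assms by auto
  ultimately show ?thesis
    unfolding assms(1) sector_coord_def Let_def point_def direction_def
    by (elim disjE) (simp_all add: max_def algebra_simps)
qed

lemma closed_segment_pointE:
  assumes "z \<in> closed_segment (point n) (point m)"
  obtains u where "0 \<le> u" "u \<le> 1" "z = (1 - of_real u) * point n + of_real u * point m"
    "\<And>j. j < 3 \<Longrightarrow> sector_coord j z =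
      (if n mod 3 = j then (1 - u) * real n else 0) + (if m mod 3 = j then u * real m else 0)"
proof -
  obtain u where "0 \<le> u" "u \<le> 1" "z = (1 - of_real u) * point n + of_real u * point m"
    using assms unfolding closed_segment_def scaleR_conv_of_real by auto
  then show ?thesis
    using that sector_coord_segment by blast
qed

lemma sector_coord_point: "j < 3 \<Longrightarrow> sector_coord j (point n) = (if n mod 3 = j then real n else 0)"
  using sector_coord_segment[of "point n" 0 n n j] by auto

lemma inj_point: "inj point"
proof (rule injI)
  fix n m assume eq: "point n = point m"
  \<comment> \<open>If the residues differ, the two equations force \<open>n = 0\<close> and
    \<open>m = 0\<close>.\<close>
  then have "sector_coord (n mod 3) (point n) = sector_coord (n mod 3) (point m)"
    and "sector_coord (m mod 3) (point n) = sector_coord (m mod 3) (point m)"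
    by simp_all
  then show "n = m"
    by (auto simp: sector_coord_point split: if_splits)
qed

section \<open>Edges of the band of width three\<close>

definition band_adjacent :: "nat \<Rightarrow> nat \<Rightarrow> bool" where
  "band_adjacent n m \<longleftrightarrow> 0 < n \<and> 0 < m \<and> n \<noteq> m \<and> n \<le> m + 3 \<and> m \<le> n + 3"

lemma mod_3_eq_gap:
  fixes n m :: nat
  assumes "n mod 3 = m mod 3" "n < m"
  shows "n + 3 \<le> m"
proof -
  have "3 dvd m - n"
    using assms by (metis less_imp_le mod_eq_dvd_iff_nat)
  then have "3 \<le> m - n"
    using assms(2) by (intro dvd_imp_le) auto
  then show ?thesis
    by linarith
qed

text \<open>Ends on one ray differ by exactly 3. Naming the smaller end \<open>l\<close> removes the
  orientation of the edge and confines inner points to positions strictly between \<open>l\<close>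
  and \<open>l + 3\<close>.\<close>

lemma collinear_edge:
  assumes "band_adjacent n m" "n mod 3 = m mod 3" "0 < u" "u < 1"
  obtains l where "{n, m} = {l, l + 3}" "l mod 3 = n mod 3"
    "real l < (1 - u) * real n + u * real m" "(1 - u) * real n + u * real m < real l + 3"
proof (cases "n < m")
  case True
  then have m: "m = n + 3"
    using assms(1) mod_3_eq_gap[OF assms(2)] by (auto simp: band_adjacent_def)
  show ?thesis
    using assms(3,4) unfolding m by (intro that[of n]) (auto simp: m algebra_simps)
next
  case False
  then have n: "n = m + 3"
    using assms(1) mod_3_eq_gap[OF assms(2)[symmetric]] by (auto simp: band_adjacent_def)
  show ?thesis
    using assms(3,4) unfolding n by (intro that[of m]) (auto simp: n algebra_simps)
qed

lemma point_mem_segment: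
  assumes "band_adjacent n m" "point k \<in> closed_segment (point n) (point m)"
  shows "k = n \<or> k = m"
proof -
  obtain u where u: "0 \<le> u" "u \<le> 1" "point k = (1 - of_real u) * point n + of_real u * point m"
    and coord: "\<And>j. j < 3 \<Longrightarrow> (if k mod 3 = j then real k else 0) =
      (if n mod 3 = j then (1 - u) * real n else 0) + (if m mod 3 = j then u * real m else 0)"
    using closed_segment_pointE[OF assms(2)] sector_coord_point by metis
  consider "u = 0" | "u = 1" | "0 < u" "u < 1"
    using u by linarith
  then show ?thesis
  proof cases
    case 1
    then show ?thesis using u(3) inj_point by (auto dest: injD)
  next
    case 2
    then show ?thesis using u(3) inj_point by (auto dest: injD)
  next
    case 3
    \<comment> \<open>An inner point has positive coordinates on the rays of both ends, whereas
      \<open>point k\<close> has at most one nonzero coordinate; so all three lie on one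
      ray.\<close>
    then have pos: "0 < (1 - u) * real n" "0 < u * real m"
      using assms(1) by (auto simp: band_adjacent_def)
    have nk: "n mod 3 = k mod 3" and mk: "m mod 3 = k mod 3"
      using coord[of "n mod 3"] coord[of "m mod 3"] pos by (auto split: if_splits)
    then obtain l where l: "l mod 3 = n mod 3" "real l < (1 - u) * real n + u * real m"
        "(1 - u) * real n + u * real m < real l + 3"
      using collinear_edge[OF assms(1) _ 3] by metis
    have "real k = (1 - u) * real n + u * real m"
      using coord[of "k mod 3"] nk mk by auto
    then have "l < k" "k < l + 3"
      using l(2,3) by linarith+
    then show ?thesis
      using mod_3_eq_gap[of l k] l(1) nk by simp
  qed
qed

text \<open>Otherwise \<open>n + 3 \<le> n' \<le> m' + 3 \<le> m \<le> n + 3\<close>, so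
  \<open>m = n + 3\<close> would lie on the ray of \<open>n\<close>.\<close>

lemma zigzag_monotone:
  assumes "band_adjacent n m" "band_adjacent n' m'"
    and "n mod 3 = n' mod 3" "m mod 3 = m' mod 3" "n mod 3 \<noteq> m mod 3"
    and "n < n'"
  shows "m \<le> m'"
proof (rule ccontr)
  assume "\<not> m \<le> m'"
  then have "m' + 3 \<le> m" "n + 3 \<le> n'"
    using mod_3_eq_gap assms(3,4,6) by simp_all
  then have "m = n + 3"
    using assms(1,2) by (simp add: band_adjacent_def)
  then show False
    using assms(5) by simp
qed

text \<open>If \<open>n < n'\<close>, equality of the first coordinates forces \<open>u < v\<close>,
  while monotonicity gives \<open>m \<le> m'\<close>; then the second coordinates cannot
  agree.\<close>

lemma zigzag_disjoint:
  assumes adj: "band_adjacent n m" "band_adjacent n' m'"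
    and cls: "n mod 3 = n' mod 3" "m mod 3 = m' mod 3" "n mod 3 \<noteq> m mod 3"
    and u: "0 < u" "u < 1" and v: "0 < v" "v < 1"
    and eq: "(1 - u) * real n = (1 - v) * real n'" "u * real m = v * real m'"
  shows "n = n' \<and> m = m'"
proof -
  \<comment> \<open>Stated for arbitrary edges so that it can be applied in both orders.\<close>
  have le: "n' \<le> n"
    if adj: "band_adjacent n m" "band_adjacent n' m'"
      and cls: "n mod 3 = n' mod 3" "m mod 3 = m' mod 3" "n mod 3 \<noteq> m mod 3"
      and u: "0 < u" "u < 1" and v: "0 < v" "v < 1"
      and eq: "(1 - u) * real n = (1 - v) * real n'" "u * real m = v * real m'"
    for n m n' m' :: nat and u v :: real
  proof (rule ccontr)
    assume "\<not> n' \<le> n"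
    then have "n < n'" by simp
    then have "m \<le> m'"
      using zigzag_monotone[OF adj cls] by blast
    have "(1 - v) * real n' < (1 - u) * real n'"
      using \<open>n < n'\<close> u by (subst eq(1)[symmetric]) simp
    then have "u < v"
      using \<open>n < n'\<close> by (simp add: mult_less_cancel_right)
    moreover have "0 < m'"
      using adj(2) by (simp add: band_adjacent_def)
    ultimately have "u * real m' < v * real m'"
      by simp
    also have "\<dots> \<le> u * real m'"
      using \<open>m \<le> m'\<close> u by (subst eq(2)[symmetric]) simp
    finally show False by simp
  qed
  have "n = n'"
    using le[OF adj cls u v eq] le[OF adj(2,1) cls(1,2)[symmetric] _ v u eq[symmetric]] cls by simp
  moreover have "0 < n" "0 < m'"
    using adj by (auto simp: band_adjacent_def)
  ultimately show ?thesis
    using eq u by auto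
qed

lemma segments_Int:
  assumes adj: "band_adjacent n m" "band_adjacent n' m'" and ne: "{n, m} \<noteq> {n', m'}"
    and z: "z \<in> closed_segment (point n) (point m)" "z \<in> closed_segment (point n') (point m')"
  shows "z \<in> point ` ({n, m} \<inter> {n', m'})"
proof (cases "z \<in> point ` {n, m} \<or> z \<in> point ` {n', m'}")
  case True
  then obtain k where k: "z = point k"
    by blast
  then have "k \<in> {n, m}" "k \<in> {n', m'}"
    using point_mem_segment[OF adj(1), of k] point_mem_segment[OF adj(2), of k] z by auto
  then show ?thesis
    using k by blast
next
  case False
  obtain u where u: "0 \<le> u" "u \<le> 1" "z = (1 - of_real u) * point n + of_real u * point m"
    and cu: "\<And>j. j < 3 \<Longrightarrow> sector_coord j z =
      (if n mod 3 = j then (1 - u) * real n else 0) + (if m mod 3 = j then u * real m else 0)"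
    using closed_segment_pointE[OF z(1)] by blast
  obtain v where v: "0 \<le> v" "v \<le> 1" "z = (1 - of_real v) * point n' + of_real v * point m'"
    and cv: "\<And>j. j < 3 \<Longrightarrow> sector_coord j z =
      (if n' mod 3 = j then (1 - v) * real n' else 0) + (if m' mod 3 = j then v * real m' else 0)"
    using closed_segment_pointE[OF z(2)] by blast
  have u1: "0 < u" "u < 1" and v1: "0 < v" "v < 1"
    using u v False by (auto simp: less_le)
  have pos: "0 < (1 - u) * real n" "0 < u * real m" "0 < (1 - v) * real n'" "0 < v * real m'"
    using u1 v1 adj by (auto simp: band_adjacent_def)
  have coord: "(if n mod 3 = j then (1 - u) * real n else 0) + (if m mod 3 = j then u * real m else 0) =
      (if n' mod 3 = j then (1 - v) * real n' else 0) + (if m' mod 3 = j then v * real m' else 0)"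
    if "j < 3" for j
    using cu[OF that] cv[OF that] by simp
  \<comment> \<open>The positive coordinates of \<open>z\<close> reveal which rays carry the ends,
    so both edges use the same rays.\<close>
  have pos_iff: "0 < (if P then x else 0) + (if R then y else 0) \<longleftrightarrow> P \<or> R"
    if "0 < x" "0 < y" for P R and x y :: real
    using that by auto
  have iff: "(n mod 3 = j \<or> m mod 3 = j) \<longleftrightarrow> (n' mod 3 = j \<or> m' mod 3 = j)" if "j < 3" for j
    using pos_iff[OF pos(1,2), of "n mod 3 = j" "m mod 3 = j"]
      pos_iff[OF pos(3,4), of "n' mod 3 = j" "m' mod 3 = j"] coord[OF that] by argo
  have "n' mod 3 = n mod 3 \<or> m' mod 3 = n mod 3" "n' mod 3 = m mod 3 \<or> m' mod 3 = m mod 3"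
    "n mod 3 = n' mod 3 \<or> m mod 3 = n' mod 3" "n mod 3 = m' mod 3 \<or> m mod 3 = m' mod 3"
    using iff[of "n mod 3"] iff[of "m mod 3"] iff[of "n' mod 3"] iff[of "m' mod 3"]
    by (simp_all del: mod_mod_trivial)
  then consider
      (collinear) "n mod 3 = m mod 3" "n' mod 3 = m' mod 3" "n mod 3 = n' mod 3"
    | (parallel) "n mod 3 \<noteq> m mod 3" "n mod 3 = n' mod 3" "m mod 3 = m' mod 3"
    | (antiparallel) "n mod 3 \<noteq> m mod 3" "n mod 3 = m' mod 3" "m mod 3 = n' mod 3"
    by metis
  then have "{n, m} = {n', m'}"
  proof cases
    case collinear
    obtain l where l: "{n, m} = {l, l + 3}" "l mod 3 = n mod 3"
        "real l < (1 - u) * real n + u * real m" "(1 - u) * real n + u * real m < real l + 3"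
      using collinear_edge[OF adj(1) collinear(1) u1] by metis
    obtain l' where l': "{n', m'} = {l', l' + 3}" "l' mod 3 = n' mod 3"
        "real l' < (1 - v) * real n' + v * real m'" "(1 - v) * real n' + v * real m' < real l' + 3"
      using collinear_edge[OF adj(2) collinear(2) v1] by metis
    have "(1 - u) * real n + u * real m = (1 - v) * real n' + v * real m'"
      using coord[of "n mod 3"] collinear by simp
    \<comment> \<open>The open intervals from \<open>l\<close> to \<open>l + 3\<close> and from
      \<open>l'\<close> to \<open>l' + 3\<close> share a position, and \<open>l\<close>,
      \<open>l'\<close> are congruent modulo 3.\<close>
    then have "l < l' + 3" "l' < l + 3"
      using l(3,4) l'(3,4) by linarith+
    then have "l = l'"
      using mod_3_eq_gap[of l l'] mod_3_eq_gap[of l' l] l(2) l'(2) collinear(3) by linarith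
    then show ?thesis
      using l(1) l'(1) by simp
  next
    case parallel
    then have "(1 - u) * real n = (1 - v) * real n'" "u * real m = v * real m'"
      using coord[of "n mod 3"] coord[of "m mod 3"] by auto
    then show ?thesis
      using zigzag_disjoint[OF adj parallel(2,3,1) u1 v1] by simp
  next
    case antiparallel
    \<comment> \<open>Reading the second edge backwards replaces \<open>v\<close> by
      \<open>1 - v\<close>.\<close>
    then have "(1 - u) * real n = (1 - (1 - v)) * real m'" "u * real m = (1 - v) * real n'"
      using coord[of "n mod 3"] coord[of "m mod 3"] by auto
    moreover have "band_adjacent m' n'"
      using adj(2) by (auto simp: band_adjacent_def)
    ultimately show ?thesis
      using zigzag_disjoint[OF adj(1) _ antiparallel(2,3,1) u1, of "1 - v"] v1 by auto
  qed
  with ne show ?thesis by simp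
qed

text \<open>One drawing serves every \<open>N\<close> and every \<open>Q \<le> 3\<close>, since all
  these graphs are subgraphs of the infinite band of width three.\<close>

lemma band_planar:
  assumes edges: "\<And>e. e \<in> snd G \<Longrightarrow> \<exists>n m. e = {n, m} \<and> band_adjacent n m"
    and sub: "\<And>e. e \<in> snd G \<Longrightarrow> e \<subseteq> fst G"
  shows "planar G"
proof -
  \<comment> \<open>Edges are unordered sets, so \<open>Min\<close> and \<open>Max\<close> choose an
    orientation.\<close>
  define c where "c = (\<lambda>e. linepath (point (Min e)) (point (Max e)))"
  have c: "arc (c {n, m}) \<and> {pathstart (c {n, m}), pathfinish (c {n, m})} = point ` {n, m} \<and>
      path_image (c {n, m}) = closed_segment (point n) (point m)"
    if "band_adjacent n m" for n m
  proof -
    have "n \<noteq> m"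
      using that by (simp add: band_adjacent_def)
    then show ?thesis
      using inj_point closed_segment_commute
      by (auto simp: c_def min_def max_def inj_eq)
  qed
  have "plane_drawing G point c"
    unfolding plane_drawing_def
  proof (intro conjI ballI impI)
    show "inj_on point (fst G)"
      using inj_point by (rule inj_on_subset) simp
  next
    fix e assume e: "e \<in> snd G"
    then obtain n m where nm: "e = {n, m}" "band_adjacent n m"
      using edges by blast
    show "arc (c e)" "{pathstart (c e), pathfinish (c e)} = point ` e"
      using c[OF nm(2)] nm(1) by simp_all
    show "path_image (c e) \<inter> point ` fst G = point ` e"
      using c[OF nm(2)] nm(1) point_mem_segment[OF nm(2)] sub[OF e] by auto
  next
    fix e f assume "e \<in> snd G" "f \<in> snd G" "e \<noteq> f"
    moreover obtain n m n' m' where "e = {n, m}" "band_adjacent n m" "f = {n', m'}" "band_adjacent n' m'"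
      using edges calculation by metis
    ultimately show "path_image (c e) \<inter> path_image (c f) \<subseteq> point ` (e \<inter> f)"
      using segments_Int[of n m n' m'] c by blast
  qed
  then show ?thesis
    unfolding planar_def by blast
qed

section \<open>The band-connected RIS\<close>

lemma band_connected_ris_5:
  assumes "4 \<le> Q"
  shows "band_connected_ris Q 5 = complete_graph {1..5}"
proof -
  have "e \<in> snd (band_connected_ris Q 5) \<longleftrightarrow> e \<subseteq> {1..5} \<and> card e = 2" for e
  proof
    assume "e \<in> snd (band_connected_ris Q 5)"
    then show "e \<subseteq> {1..5} \<and> card e = 2"
      by (auto simp: band_connected_ris_def)
  next
    assume "e \<subseteq> {1..5} \<and> card e = 2"
    then obtain n m where e: "e = {n, m}" "n \<noteq> m" "n \<in> {1..5}" "m \<in> {1..5}"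
      by (auto simp: card_2_iff)
    moreover have "\<bar>int n - int m\<bar> \<le> int Q"
      using assms e(3,4) by auto
    ultimately show "e \<in> snd (band_connected_ris Q 5)"
      by (simp add: band_connected_ris_edge_iff)
  qed
  then show ?thesis
    by (auto simp: complete_graph_def band_connected_ris_def)
qed

theorem proposition4:
  fixes Q :: nat
  assumes "Q \<ge> 1"
  shows "planar_connected (band_connected_ris Q) \<longleftrightarrow> Q \<le> 3"
proof
  assume "planar_connected (band_connected_ris Q)"
  then have "planar (band_connected_ris Q 5)"
    by (simp add: planar_connected_def)
  then show "Q \<le> 3"
    using band_connected_ris_5[of Q] complete_graph_5_not_planar[of "{1..5 :: nat}"] by fastforce
next
  assume Q: "Q \<le> 3"
  have "planar (band_connected_ris Q N)" for N
  proof (rule band_planar)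
    fix e assume "e \<in> snd (band_connected_ris Q N)"
    then obtain n m where e: "e = {n, m}" "n \<in> {1..N}" "m \<in> {1..N}" "n \<noteq> m"
        "\<bar>int n - int m\<bar> \<le> int Q"
      by (auto simp: band_connected_ris_def)
    then have "band_adjacent n m"
      using Q by (auto simp: band_adjacent_def)
    then show "\<exists>n m. e = {n, m} \<and> band_adjacent n m"
      using e(1) by blast
    show "e \<subseteq> fst (band_connected_ris Q N)"
      using e by (simp add: band_connected_ris_def)
  qed
  then show "planar_connected (band_connected_ris Q)"
    by (simp add: planar_connected_def)
qed

end
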